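(* Let $G$ be a finite group and let $\mathfrak{S}$ be any commutative Schur ring for $G$ with principal sets $P_0,P_1,\dots,P_d$. Let $T(G,\mathfrak{S})$ be the Terwilliger algebra (with base point $e$) of the association scheme on $G$ determined by $\mathfrak{S}$. Then $T(G,\mathfrak{S})$ is almost commutative if and only if $\mathfrak{S}$ has the following property: for all $x,y\in G$, if $x\in P_i$, $y\in P_j$, $xy\in P_h$ and $P_i\neq P_j^*$, then $P_iP_j=P_h$.
   Context: For $C\subseteq G$, $\overline{C}=\sum_{g\in C}g\in\mathbb{C}[G]$, $C^*=\{g^{-1}:g\in C\}$, and $P_iP_j=\{ab: a\in P_i,b\in P_j\}$. A Schur ring for $G$: given a partition $\mathcal{P}$ of $G$, $\mathfrak{S}=\mathrm{Span}\{\overline{C}:C\in\mathcal{P}\}$ is a Schur ring if $\{e\}\in\mathcal{P}$; $C\in\mathcal{P}$ implies $C^*\in\mathcal{P}$; and for all $C,D\in\mathcal{P}$, $\overline{C}\cdot\overline{D}=\sum_{E\in\mathcal{P}}\lambda_{CDE}\overline{E}$ for some constants $\lambda_{CDE}$. The sets in $\mathcal{P}$ are its principal sets ($P_0=\{e\}$). The associated association scheme on $G$ has adjacency matrices $A_0,\dots,A_d$, $(A_i)_{xy}=1$ if $yx^{-1}\in P_i$ and $0$ otherwise; it is commutative when $\mathfrak{S}$ is. Let $E_i^*$ be the diagonal matrix with $(E_i^* )_{yy}=1$ if $y\in P_i$ and $0$ otherwise. The Terwilliger algebra $T(G,\mathfrak{S})$ (base point $e$) is the subalgebra of $M_{|G|}(\mathbb{C})$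 generated by all the $A_i$ and $E_i^*$; it is semisimple. With $\hat{e}\in\mathbb{C}^{|G|}$ the standard basis vector at $e$, the subspace $\mathrm{Span}\{A_0,\dots,A_d\}\hat{e}$ is an irreducible $T(G,\mathfrak{S})$-module, the primary module. The algebra is almost commutative if every irreducible submodule of $\mathbb{C}^{|G|}$ (under left multiplication) not isomorphic to the primary module is $1$-dimensional. *)

theory Defs
  imports "HOL-Analysis.Analysis" "HOL-Algebra.Coset"
begin

text \<open>
  A finite group is a HOL-Algebra group whose carrier is the whole of a finite type \<open>'g\<close>, so
  that \<open>'g\<close> can index the vectors of type \<open>complex ^ 'g\<close> and the matrices of type
  \<open>complex ^ 'g ^ 'g\<close>.  Complex subspaces, spans and dimensions are those of \<open>vec\<close>, the
  interpretation of vector spaces for \<open>(*s)\<close>.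
\<close>

section \<open>The group algebra and Schur rings\<close>

text \<open>An element of the group algebra over the complex numbers is represented by its vector of
  coefficients; addition and scalar multiplication are the pointwise ones.\<close>

definition group_algebra_mult ::
  "('g::finite, 'b) monoid_scheme \<Rightarrow> complex ^ 'g \<Rightarrow> complex ^ 'g \<Rightarrow> complex ^ 'g"
  where "group_algebra_mult G a b =
    (\<chi> z. \<Sum>(x, y) \<in> {(x, y) \<in> carrier G \<times> carrier G. x \<otimes>\<^bsub>G\<^esub> y = z}. a $ x * b $ y)"

definition basic_sum :: "'g::finite set \<Rightarrow> complex ^ 'g"
  where "basic_sum C = (\<Sum>g\<in>C. axis g 1)"

definition schur_ring ::
  "('g::finite, 'b) monoid_scheme \<Rightarrow> 'g set set \<Rightarrow> (complex ^ 'g) set \<Rightarrow> bool"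
  where "schur_ring G \<P> S \<longleftrightarrow>
    partition_on (carrier G) \<P> \<and>
    S = vec.span (basic_sum ` \<P>) \<and>
    {\<one>\<^bsub>G\<^esub>} \<in> \<P> \<and>
    (\<forall>C\<in>\<P>. set_inv\<^bsub>G\<^esub> C \<in> \<P>) \<and>
    (\<forall>C\<in>\<P>. \<forall>D\<in>\<P>. \<exists>l :: 'g set \<Rightarrow> complex.
       group_algebra_mult G (basic_sum C) (basic_sum D) = (\<Sum>E\<in>\<P>. l E *s basic_sum E))"

definition commutative_schur_ring ::
  "('g::finite, 'b) monoid_scheme \<Rightarrow> 'g set set \<Rightarrow> (complex ^ 'g) set \<Rightarrow> bool"
  where "commutative_schur_ring G \<P> S \<longleftrightarrow>
    schur_ring G \<P> S \<and>
    (\<forall>a\<in>S. \<forall>b\<in>S. group_algebra_mult G a b = group_algebra_mult G b a)"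

section \<open>The Terwilliger algebra\<close>

definition adjacency_matrix ::
  "('g::finite, 'b) monoid_scheme \<Rightarrow> 'g set \<Rightarrow> complex ^ 'g ^ 'g"
  where "adjacency_matrix G C = (\<chi> x y. if y \<otimes>\<^bsub>G\<^esub> inv\<^bsub>G\<^esub> x \<in> C then 1 else 0)"

definition dual_idempotent :: "'g::finite set \<Rightarrow> complex ^ 'g ^ 'g"
  where "dual_idempotent C = (\<chi> x y. if x = y \<and> y \<in> C then 1 else 0)"

definition matrix_scale :: "complex \<Rightarrow> complex ^ 'g ^ 'g \<Rightarrow> complex ^ 'g ^ ('g::finite)"
  where "matrix_scale c M = (\<chi> x y. c * M $ x $ y)"

definition matrix_subalgebra :: "(complex ^ 'g ^ ('g::finite)) set \<Rightarrow> bool"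
  where "matrix_subalgebra T \<longleftrightarrow>
    mat 1 \<in> T \<and>
    (\<forall>M\<in>T. \<forall>N\<in>T. M + N \<in> T) \<and>
    (\<forall>c. \<forall>M\<in>T. matrix_scale c M \<in> T) \<and>
    (\<forall>M\<in>T. \<forall>N\<in>T. M ** N \<in> T)"

definition terwilliger_algebra ::
  "('g::finite, 'b) monoid_scheme \<Rightarrow> 'g set set \<Rightarrow> (complex ^ 'g ^ 'g) set"
  where "terwilliger_algebra G \<P> =
    matrix_subalgebra hull (adjacency_matrix G ` \<P> \<union> dual_idempotent ` \<P>)"

section \<open>Modules of the Terwilliger algebra\<close>

definition submodule :: "(complex ^ 'g ^ ('g::finite)) set \<Rightarrow> (complex ^ 'g) set \<Rightarrow> bool"
  where "submodule T W \<longleftrightarrow> vec.subspace W \<and> (\<forall>M\<in>T. \<forall>w\<in>W. M *v w \<in> W)"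

definition irreducible_submodule ::
  "(complex ^ 'g ^ ('g::finite)) set \<Rightarrow> (complex ^ 'g) set \<Rightarrow> bool"
  where "irreducible_submodule T W \<longleftrightarrow>
    submodule T W \<and> W \<noteq> {0} \<and> (\<forall>U. submodule T U \<and> U \<subseteq> W \<longrightarrow> U = {0} \<or> U = W)"

definition isomorphic_submodules ::
  "(complex ^ 'g ^ ('g::finite)) set \<Rightarrow> (complex ^ 'g) set \<Rightarrow> (complex ^ 'g) set \<Rightarrow> bool"
  where "isomorphic_submodules T V W \<longleftrightarrow>
    (\<exists>f. bij_betw f V W \<and>
      (\<forall>u\<in>V. \<forall>v\<in>V. f (u + v) = f u + f v) \<and>
      (\<forall>c. \<forall>v\<in>V. f (c *s v) = c *s f v) \<and>
      (\<forall>M\<in>T. \<forall>v\<in>V. f (M *v v) = M *v f v))"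

definition adjacency_span ::
  "('g::finite, 'b) monoid_scheme \<Rightarrow> 'g set set \<Rightarrow> (complex ^ 'g ^ 'g) set"
  where "adjacency_span G \<P> =
    {(\<Sum>C\<in>\<P>. matrix_scale (c C) (adjacency_matrix G C)) | c. True}"

definition primary_module ::
  "('g::finite, 'b) monoid_scheme \<Rightarrow> 'g set set \<Rightarrow> (complex ^ 'g) set"
  where "primary_module G \<P> = (\<lambda>M. M *v axis \<one>\<^bsub>G\<^esub> 1) ` adjacency_span G \<P>"

definition terwilliger_almost_commutative ::
  "('g::finite, 'b) monoid_scheme \<Rightarrow> 'g set set \<Rightarrow> bool"
  where "terwilliger_almost_commutative G \<P> \<longleftrightarrow>
    (\<forall>W. irreducible_submodule (terwilliger_algebra G \<P>) W \<and>
         \<not> isomorphic_submodules (terwilliger_algebra G \<P>) W (primary_module G \<P>) \<longrightarrow>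
         vec.dim W = 1)"

end

theory Submission
  imports Defs "HOL-Computational_Algebra.Fundamental_Theorem_Algebra"
begin

text \<open>
  The primary module consists of the vectors that are constant on every principal set, and its
  orthogonal complement \<open>Z\<close> of the vectors whose sum over every principal set is \<open>0\<close>.  The proof
  passes through the condition that the generators \<open>A_C\<close> and \<open>E_D\<^sup>*\<close> of the Terwilliger algebra commute
  with each other on \<open>Z\<close>.

  Almost commutativity is equivalent to this condition.  An irreducible module that is not isomorphic
  to the primary module lies in \<open>Z\<close>: from a vector with nonzero sum over a principal set the algebra
  produces the basis vector at the identity, and this vector generates the primary module.
  Conversely no submodule of \<open>Z\<close> is isomorphic to the primary module, because the idempotent of
  \<open>{e}\<close> kills \<open>Z\<close> but not the primary module.  So the algebra is almost commutative if and only if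
  every irreducible submodule of \<open>Z\<close> has dimension 1.  If the generators commute on \<open>Z\<close>, the
  dimension is 1 by Schur's argument (\<open>irreducible_commuting_dim_1\<close>).  In the other direction the
  generators are closed under conjugate transposition, so \<open>Z\<close> is an orthogonal sum of irreducible
  submodules; on lines the generators act as scalars, hence they commute
  (\<open>irreducibles_dim_1_imp_commuting\<close>).

  The \<open>A_C\<close> commute because the Schur ring does, and the \<open>E_D\<^sup>*\<close> are diagonal.  What is left is that
  \<open>A_C\<close> commutes with \<open>E_D\<^sup>*\<close> on \<open>Z\<close>.  This says that the blocks of \<open>A_C\<close> between different principal
  sets vanish on vectors of sum 0, that is, that every row of such a block is constant
  (\<open>commuting_iff_constant_off_diagonal\<close>).  Applied to \<open>C\<close> and to \<open>C\<^sup>*\<close>, this makes rows and columns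
  constant, so the block is all ones or zero.  The entry of \<open>A_C\<close> at \<open>(y\<^sup>-\<^sup>1, x)\<close> records whether
  \<open>x y \<in> C\<close>, so all-ones or zero blocks mean that \<open>P_i P_j\<close> meets only one principal set whenever
  \<open>P_i \<noteq> P_j\<^sup>*\<close> (\<open>constant_off_diagonal_iff_single_class_products\<close>).
\<close>

section \<open>Modules over a generated matrix algebra\<close>

text \<open>The matrices that map a given subspace into itself form an algebra, so invariance has to be
  checked on generators only.\<close>

lemma submodule_hull_iff:
  "submodule (matrix_subalgebra hull X) W \<longleftrightarrow>
     vec.subspace W \<and> (\<forall>M\<in>X. \<forall>w\<in>W. M *v w \<in> W)"
proof safe
  assume "submodule (matrix_subalgebra hull X) W"
  then show "vec.subspace W" "\<And>M w. M \<in> X \<Longrightarrow> w \<in> W \<Longrightarrow> M *v w \<in> W"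
    by (auto simp: submodule_def hull_inc)
next
  assume W: "vec.subspace W" and X: "\<forall>M\<in>X. \<forall>w\<in>W. M *v w \<in> W"
  have scale: "matrix_scale c M *v w = c *s (M *v w)" for c M and w :: "complex ^ 'a"
    by (simp add: vec_eq_iff matrix_scale_def matrix_vector_mult_def sum_distrib_left mult.assoc)
  let ?T = "{M. \<forall>w\<in>W. M *v w \<in> W}"
  have "matrix_subalgebra ?T"
    using W by (auto simp: matrix_subalgebra_def scale matrix_vector_mult_add_rdistrib
        vec.subspace_add vec.subspace_scale simp flip: matrix_vector_mul_assoc)
  then have "matrix_subalgebra hull X \<subseteq> ?T"
    using X by (intro hull_minimal) auto
  then show "submodule (matrix_subalgebra hull X) W"
    using W by (auto simp: submodule_def)
qed

lemma dim_span_singleton: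
  assumes "(w :: complex ^ 'n) \<noteq> 0"
  shows "vec.dim (vec.span {w}) = 1"
  using assms vec.dim_eq_card_independent[of "{w}"] by (simp add: vec.dim_span)

lemma matrix_vector_mult_sum:
  "(M :: complex ^ 'n ^ 'm) *v (sum f A) = (\<Sum>i\<in>A. M *v f i)"
  by (induction A rule: infinite_finite_induct) (simp_all add: matrix_vector_right_distrib)

section \<open>Irreducible modules of commuting matrices\<close>

text \<open>The vector \<open>p(M) w\<close>, evaluated by the Horner scheme.  Polynomials in \<open>M\<close> give eigenvectors inside
  an arbitrary invariant subspace, where no matrix of the restricted map is at hand.\<close>

definition poly_act :: "complex ^ 'n ^ 'n \<Rightarrow> complex ^ 'n \<Rightarrow> complex poly \<Rightarrow> complex ^ ('n::finite)"
  where "poly_act M w p = fold_coeffs (\<lambda>a v. a *s w + M *v v) p 0"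

lemma poly_act_0: "poly_act M w 0 = 0"
  by (simp add: poly_act_def)

lemma poly_act_pCons: "poly_act M w (pCons a p) = a *s w + M *v poly_act M w p"
  by (cases "a = 0 \<and> p = 0") (auto simp: poly_act_def)

lemma poly_act_add: "poly_act M w (p + q) = poly_act M w p + poly_act M w q"
proof (induction p q rule: poly_induct2)
  case (pCons a p b q)
  then show ?case
    by (simp add: poly_act_pCons matrix_vector_right_distrib vector_sadd_rdistrib algebra_simps)
qed (simp add: poly_act_0)

lemma poly_act_smult: "poly_act M w (smult c p) = c *s poly_act M w p"
  by (induction p)
    (simp_all add: poly_act_0 poly_act_pCons vector_scalar_commute vector_add_ldistrib vector_smult_assoc)

lemma poly_act_diff: "poly_act M w (p - q) = poly_act M w p - poly_act M w q"
  using poly_act_add[of M w "p - q" q] by simp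

lemma poly_act_sum: "poly_act M w (sum f A) = (\<Sum>i\<in>A. poly_act M w (f i))"
  by (induction A rule: infinite_finite_induct) (simp_all add: poly_act_0 poly_act_add)

lemma poly_act_in_subspace:
  assumes "vec.subspace W" "\<And>v. v \<in> W \<Longrightarrow> M *v v \<in> W" "w \<in> W"
  shows "poly_act M w p \<in> W"
  using assms by (induction p)
    (auto simp: poly_act_0 poly_act_pCons vec.subspace_0 vec.subspace_add vec.subspace_scale)

text \<open>The vectors \<open>w, M w, M\<^sup>2 w, \<dots>\<close> up to the exponent \<open>CARD('n)\<close> are one more than the dimension, so
  two of them agree or they are linearly dependent.\<close>

lemma annihilating_poly_exists:
  fixes M :: "complex ^ 'n ^ 'n"
  obtains p where "p \<noteq> 0" "poly_act M w p = 0"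
proof -
  let ?f = "\<lambda>i. poly_act M w (monom 1 i)"
  let ?I = "{..CARD('n)}"
  show thesis
  proof (cases "inj_on ?f ?I")
    case False
    then obtain i j where "i \<noteq> j" "?f i = ?f j"
      by (auto simp: inj_on_def)
    then have "monom 1 i - monom 1 j \<noteq> (0 :: complex poly)"
      by (simp add: monom_eq_iff')
    then show thesis
      using that[of "monom 1 i - monom 1 j"] \<open>?f i = ?f j\<close> by (simp add: poly_act_diff)
  next
    case True
    have "vec.dependent (?f ` ?I)"
    proof (rule ccontr)
      assume "vec.independent (?f ` ?I)"
      then have "card (?f ` ?I) \<le> vec.dim (?f ` ?I)"
        by (simp add: vec.dim_eq_card_independent)
      also have "\<dots> \<le> CARD('n)"
        by (rule dim_subset_UNIV_cart_gen)
      finally show False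
        using card_image[OF True] by simp
    qed
    then obtain u j where j: "j \<in> ?I" "u (?f j) \<noteq> 0"
      and u: "(\<Sum>v\<in>?f ` ?I. u v *s v) = 0"
      by (auto simp: vec.dependent_finite)
    let ?p = "\<Sum>i\<in>?I. smult (u (?f i)) (monom 1 i)"
    have "coeff ?p j = u (?f j)"
      using j(1) by (simp add: coeff_sum if_distrib[of "\<lambda>x. _ * x"] cong: if_cong)
    then have "?p \<noteq> 0"
      using j(2) by auto
    moreover have "poly_act M w ?p = 0"
      using u by (simp add: poly_act_sum poly_act_smult sum.reindex[OF True])
    ultimately show thesis
      by (rule that)
  qed
qed

text \<open>If \<open>p(M) w = 0\<close> and \<open>p = (X - r) q\<close>, then \<open>q(M) w\<close> is either an eigenvector for \<open>r\<close> or zero; in the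
  second case \<open>q\<close> has smaller degree.  The descent ends because a nonzero constant does not
  annihilate \<open>w \<noteq> 0\<close>.\<close>

lemma invariant_subspace_has_eigenvector:
  fixes M :: "complex ^ 'n ^ 'n"
  assumes W: "vec.subspace W" "W \<noteq> {0}" and M: "\<And>v. v \<in> W \<Longrightarrow> M *v v \<in> W"
  obtains c w where "w \<in> W" "w \<noteq> 0" "M *v w = c *s w"
proof -
  obtain w where w: "w \<in> W" "w \<noteq> 0"
    using W vec.subspace_0 by blast
  have "\<exists>c v. v \<in> W \<and> v \<noteq> 0 \<and> M *v v = c *s v" if "p \<noteq> 0" "poly_act M w p = 0" for p
    using that
  proof (induction "degree p" arbitrary: p rule: less_induct)
    case less
    have "degree p \<noteq> 0"
    proof
      assume "degree p = 0"
      then obtain a where "p = [:a:]"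
        by (metis degree_eq_zeroE)
      then show False
        using less.prems w(2) by (simp add: poly_act_pCons poly_act_0)
    qed
    then have "\<not> constant (poly p)"
      by (simp add: constant_degree)
    then obtain r where "poly p r = 0"
      using fundamental_theorem_of_algebra by blast
    then obtain q where q: "p = [:- r, 1:] * q"
      by (metis dvdE poly_eq_0_iff_dvd)
    then have "q \<noteq> 0"
      using less.prems by auto
    then have "degree q < degree p"
      using q by (subst q, subst degree_mult_eq) auto
    have "p = smult (- r) q + pCons 0 q"
      by (simp add: q)
    then have "M *v poly_act M w q = r *s poly_act M w q"
      using less.prems(2) by (simp only: poly_act_add poly_act_smult poly_act_pCons) simp
    then show ?case
      using less.hyps[OF \<open>degree q < degree p\<close> \<open>q \<noteq> 0\<close>] poly_act_in_subspace[OF W(1) M w(1)]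
      by blast
  qed
  then show thesis
    using that annihilating_poly_exists by metis
qed

text \<open>Schur's argument: an eigenspace of one generator in \<open>W\<close> is invariant under all the others, because
  they commute with it on \<open>W\<close>, so it is all of \<open>W\<close>.  Hence every generator acts as a scalar and every
  line in \<open>W\<close> is a submodule.\<close>

lemma irreducible_commuting_dim_1:
  assumes irr: "irreducible_submodule (matrix_subalgebra hull X) W"
    and comm: "\<And>M N w. M \<in> X \<Longrightarrow> N \<in> X \<Longrightarrow> w \<in> W \<Longrightarrow> M *v (N *v w) = N *v (M *v w)"
  shows "vec.dim W = 1"
proof -
  have W: "vec.subspace W" "W \<noteq> {0}" and inv: "\<And>M w. M \<in> X \<Longrightarrow> w \<in> W \<Longrightarrow> M *v w \<in> W"
    using irr by (auto simp: irreducible_submodule_def submodule_hull_iff)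
  have minimal: "U = W" if "vec.subspace U" "\<And>M u. M \<in> X \<Longrightarrow> u \<in> U \<Longrightarrow> M *v u \<in> U"
    "U \<subseteq> W" "u \<in> U" "u \<noteq> 0" for U u
    using irr that by (auto simp: irreducible_submodule_def submodule_hull_iff)
  have scalar: "\<exists>c. \<forall>w\<in>W. M *v w = c *s w" if M: "M \<in> X" for M
  proof -
    obtain c u where u: "u \<in> W" "u \<noteq> 0" "M *v u = c *s u"
      using invariant_subspace_has_eigenvector[OF W, of M] inv[OF M] by metis
    have "{w \<in> W. M *v w = c *s w} = W"
    proof (rule minimal[of _ u])
      show "vec.subspace {w \<in> W. M *v w = c *s w}"
        using W(1) by (auto simp: vec.subspace_def matrix_vector_right_distrib vector_scalar_commute
            vector_add_ldistrib vector_smult_assoc mult.commute)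
    qed (use u inv comm[OF M] in \<open>auto simp: vector_scalar_commute\<close>)
    then show ?thesis
      by blast
  qed
  obtain w where w: "w \<in> W" "w \<noteq> 0"
    using W vec.subspace_0 by blast
  have "vec.span {w} = W"
  proof (rule minimal[of _ w])
    show sub: "vec.span {w} \<subseteq> W"
      using w W(1) by (simp add: vec.span_minimal)
    fix M u
    assume "M \<in> X" "u \<in> vec.span {w}"
    then show "M *v u \<in> vec.span {w}"
      using scalar sub by (metis subsetD vec.span_scale)
  qed (use w in \<open>auto simp: vec.span_base\<close>)
  then show ?thesis
    using dim_span_singleton[OF w(2)] by simp
qed

section \<open>Complete reducibility for generators closed under adjoints\<close>

definition adjoint_matrix :: "complex ^ 'n ^ 'n \<Rightarrow> complex ^ 'n ^ ('n::finite)"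
  where "adjoint_matrix M = (\<chi> i j. cnj (M $ j $ i))"

definition herm :: "complex ^ 'n \<Rightarrow> complex ^ ('n::finite) \<Rightarrow> complex"
  where "herm v u = (\<Sum>i\<in>UNIV. v $ i * cnj (u $ i))"

lemma herm_adjoint: "herm (M *v v) u = herm v (adjoint_matrix M *v u)"
  unfolding herm_def matrix_vector_mult_def adjoint_matrix_def
  by (simp add: sum_distrib_left sum_distrib_right mult_ac) (rule sum.swap)

lemma herm_add: "herm (a + b) u = herm a u + herm b u"
  by (simp add: herm_def sum.distrib algebra_simps)

lemma herm_scale: "herm (c *s a) u = c * herm a u" "herm a (c *s u) = cnj c * herm a u"
  by (simp_all add: herm_def sum_distrib_left mult_ac)

lemma herm_self_eq_0: "herm u u = 0 \<longleftrightarrow> u = 0"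
proof
  assume "herm u u = 0"
  then have "complex_of_real (\<Sum>i\<in>UNIV. (norm (u $ i))\<^sup>2) = 0"
    by (simp add: herm_def complex_norm_square del: of_real_power)
  then have "(\<Sum>i\<in>UNIV. (norm (u $ i))\<^sup>2) = 0"
    using of_real_eq_0_iff by blast
  then show "u = 0"
    by (simp add: sum_nonneg_eq_0_iff vec_eq_iff)
qed (simp add: herm_def)

text \<open>A nonzero submodule of least dimension is irreducible.\<close>

lemma irreducible_submodule_exists:
  assumes "submodule T W" "W \<noteq> {0}"
  obtains U where "irreducible_submodule T U" "U \<subseteq> W"
proof -
  let ?P = "\<lambda>U. submodule T U \<and> U \<noteq> {0} \<and> U \<subseteq> W"
  obtain U where U: "?P U" and min: "\<And>U'. ?P U' \<Longrightarrow> vec.dim U \<le> vec.dim U'"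
    using ex_has_least_nat[of ?P W "vec.dim"] assms by auto
  have "irreducible_submodule T U"
    unfolding irreducible_submodule_def
  proof (intro conjI allI impI)
    fix V
    assume V: "submodule T V \<and> V \<subseteq> U"
    show "V = {0} \<or> V = U"
    proof (cases "V = {0}")
      case False
      then have "vec.dim U \<le> vec.dim V"
        using V U min by auto
      then show ?thesis
        using V U vec.subspace_dim_equal[of V U] by (auto simp: submodule_def)
    qed simp
  qed (use U in auto)
  then show thesis
    using that U by blast
qed

text \<open>Induction on the dimension: an irreducible submodule of \<open>W\<close> is a line spanned by a common eigenvector
  \<open>u\<close>, on which the generators commute.  Since \<open>u\<close> is an eigenvector also of the adjoints, the
  orthogonal complement of \<open>u\<close> in \<open>W\<close> is a submodule of smaller dimension.\<close>

lemma irreducibles_dim_1_imp_commuting: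
  assumes adj: "\<And>M. M \<in> X \<Longrightarrow> adjoint_matrix M \<in> X"
    and W: "submodule (matrix_subalgebra hull X) W"
    and dim1: "\<And>U. irreducible_submodule (matrix_subalgebra hull X) U \<Longrightarrow> U \<subseteq> W \<Longrightarrow> vec.dim U = 1"
    and "M \<in> X" "N \<in> X" "v \<in> W"
  shows "M *v (N *v v) = N *v (M *v v)"
  using W dim1 \<open>v \<in> W\<close>
proof (induction "vec.dim W" arbitrary: W v rule: less_induct)
  case less
  note W = \<open>submodule _ W\<close>[unfolded submodule_hull_iff]
  show ?case
  proof (cases "W = {0}")
    case True
    then show ?thesis
      using less.prems by simp
  next
    case False
    then obtain U where U: "irreducible_submodule (matrix_subalgebra hull X) U" "U \<subseteq> W"
      using irreducible_submodule_exists less.prems(1) by metis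
    then have sU: "vec.subspace U" and iU: "\<And>M u. M \<in> X \<Longrightarrow> u \<in> U \<Longrightarrow> M *v u \<in> U"
      and "U \<noteq> {0}"
      by (auto simp: irreducible_submodule_def submodule_hull_iff)
    then obtain u where u: "u \<in> U" "u \<noteq> 0"
      using vec.subspace_0 by blast
    have "vec.span {u} = U"
      by (rule vec.subspace_dim_equal)
        (use u sU less.prems(2)[OF U] dim_span_singleton[OF u(2)] in \<open>auto simp: vec.span_minimal\<close>)
    then have eig: "\<exists>c. L *v u = c *s u" if "L \<in> X" for L
      using iU[OF that u(1)] by (auto simp: vec.span_singleton)
    define W' where "W' = {w \<in> W. herm w u = 0}"
    have sub: "submodule (matrix_subalgebra hull X) W'"
      unfolding submodule_hull_iff
    proof (intro conjI ballI)
      show "vec.subspace W'"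
        using W by (auto simp: W'_def vec.subspace_def herm_add herm_scale)
          (simp add: herm_def)
      fix L w
      assume L: "L \<in> X" and w: "w \<in> W'"
      obtain c where "adjoint_matrix L *v u = c *s u"
        using eig[OF adj[OF L]] by blast
      then have "herm (L *v w) u = 0"
        using w by (simp add: herm_adjoint herm_scale W'_def)
      then show "L *v w \<in> W'"
        using W L w by (simp add: W'_def)
    qed
    have "W' \<subset> W"
      using u U(2) herm_self_eq_0[of u] by (auto simp: W'_def)
    then have "vec.dim W' < vec.dim W"
      using sub W vec.subspace_dim_equal[of W' W] by (force simp: submodule_def not_le)
    \<comment> \<open>the coefficient of the orthogonal projection of \<open>v\<close> to the line of \<open>u\<close>\<close>
    define a where "a = herm v u / herm u u"
    have "v - a *s u \<in> W'"
    proof -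
      have "herm (v - a *s u) u = herm v u - a * herm u u"
        using herm_add[of "v - a *s u" "a *s u" u] by (simp add: herm_scale)
      then have "herm (v - a *s u) u = 0"
        using u(2) by (simp add: a_def herm_self_eq_0)
      then show ?thesis
        using W less.prems(3) u(1) U(2)
        by (auto simp: W'_def intro!: vec.subspace_diff vec.subspace_scale)
    qed
    then have "M *v (N *v (v - a *s u)) = N *v (M *v (v - a *s u))"
      using less.hyps[OF \<open>vec.dim W' < vec.dim W\<close> sub] less.prems(2) \<open>W' \<subset> W\<close> by blast
    moreover have "M *v (N *v u) = N *v (M *v u)"
      using eig[OF \<open>M \<in> X\<close>] eig[OF \<open>N \<in> X\<close>]
      by (auto simp: vector_scalar_commute vector_smult_assoc mult.commute)
    ultimately show ?thesis
      by (simp add: matrix_vector_mult_diff_distrib vector_scalar_commute)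
  qed
qed

section \<open>Commutative Schur partitions\<close>

lemma basic_sum_nth: "basic_sum C $ x = of_bool (x \<in> C)"
  by (simp add: basic_sum_def axis_def if_distrib sum.delta cong: if_cong)

lemma adjacency_mult_nth:
  "(adjacency_matrix G C *v v) $ x = (\<Sum>z\<in>UNIV. of_bool (z \<otimes>\<^bsub>G\<^esub> inv\<^bsub>G\<^esub> x \<in> C) * v $ z)"
  by (simp add: adjacency_matrix_def matrix_vector_mult_def of_bool_def)

lemma dual_idempotent_mult_nth: "(dual_idempotent C *v v) $ x = of_bool (x \<in> C) * v $ x"
proof -
  have "(dual_idempotent C *v v) $ x = (\<Sum>z\<in>UNIV. if x = z then of_bool (z \<in> C) * v $ z else 0)"
    unfolding dual_idempotent_def matrix_vector_mult_def vec_lambda_beta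
    by (rule sum.cong) auto
  then show ?thesis
    by simp
qed

locale commutative_schur_partition = group G
  for G :: "('g::finite, 'b) monoid_scheme" (structure) +
  fixes Q :: "'g set set" and S :: "(complex ^ 'g) set"
  assumes carrier_UNIV: "carrier G = UNIV"
    and schur: "commutative_schur_ring G Q S"
begin

lemma in_carrier [simp]: "x \<in> carrier G"
  by (simp add: carrier_UNIV)

lemma class_exists:
  obtains C where "C \<in> Q" "x \<in> C"
proof -
  have "\<Union>Q = UNIV"
    using schur carrier_UNIV
    by (simp add: commutative_schur_ring_def schur_ring_def partition_on_def)
  then show thesis
    using that by blast
qed

lemma class_unique: "C \<in> Q \<Longrightarrow> D \<in> Q \<Longrightarrow> x \<in> C \<Longrightarrow> x \<in> D \<Longrightarrow> C = D"
  using schur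
  by (auto simp: commutative_schur_ring_def schur_ring_def partition_on_def disjoint_def)

lemma one_class: "{\<one>} \<in> Q"
  using schur by (simp add: commutative_schur_ring_def schur_ring_def)

lemma set_inv_class: "C \<in> Q \<Longrightarrow> set_inv C \<in> Q"
  using schur by (simp add: commutative_schur_ring_def schur_ring_def)

lemma in_set_inv_iff: "x \<in> set_inv C \<longleftrightarrow> inv x \<in> C"
proof -
  have "\<And>h. x = inv h \<longleftrightarrow> inv x = h"
    by auto
  then show ?thesis
    by (auto simp: SET_INV_def)
qed

lemma mult_translate: "(x \<otimes> inv y) \<otimes> (y \<otimes> z) = x \<otimes> z" "(x \<otimes> inv y) \<otimes> y = x" "(x \<otimes> y) \<otimes> inv y = x"
  by (simp_all add: m_assoc) (simp_all flip: m_assoc)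

lemma group_algebra_mult_nth:
  "group_algebra_mult G a b $ z = (\<Sum>w\<in>UNIV. a $ (z \<otimes> inv w) * b $ w)"
  unfolding group_algebra_mult_def vec_lambda_beta
  by (rule sum.reindex_bij_witness[of _ "\<lambda>w. (z \<otimes> inv w, w)" snd])
    (auto simp: mult_translate)

text \<open>Different classes are disjoint, so evaluating the expansion of the product at a point of \<open>E\<close> leaves
  the coefficient of \<open>E\<close> alone: the product of two class sums is constant on classes.\<close>

lemma structure_constants:
  assumes "C \<in> Q" "D \<in> Q"
  obtains l where "\<And>E z. E \<in> Q \<Longrightarrow> z \<in> E \<Longrightarrow>
    group_algebra_mult G (basic_sum C) (basic_sum D) $ z = l E"
proof -
  obtain l where l: "group_algebra_mult G (basic_sum C) (basic_sum D) = (\<Sum>E\<in>Q. l E *s basic_sum E)"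
    using schur assms unfolding commutative_schur_ring_def schur_ring_def by blast
  have "(\<Sum>E'\<in>Q. l E' *s basic_sum E') $ z = l E" if "E \<in> Q" "z \<in> E" for E z
  proof -
    have "(\<Sum>E'\<in>Q. l E' *s basic_sum E') $ z = sum l (Q \<inter> {E'. z \<in> E'})"
      by (simp add: basic_sum_nth)
    also have "Q \<inter> {E'. z \<in> E'} = {E}"
      using that class_unique by blast
    finally show ?thesis
      by simp
  qed
  then show thesis
    using that l by metis
qed

lemma basic_sum_commute:
  assumes "C \<in> Q" "D \<in> Q"
  shows "group_algebra_mult G (basic_sum C) (basic_sum D)
    = group_algebra_mult G (basic_sum D) (basic_sum C)"
  using schur assms by (auto simp: commutative_schur_ring_def schur_ring_def vec.span_base)

text \<open>\<open>C \<mapsto> A_C\<close> reverses products, with the convention that the entry at \<open>(x, y)\<close> depends on \<open>y x\<^sup>-\<^sup>1\<close>.\<close>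

lemma adjacency_product_nth:
  "(adjacency_matrix G C ** adjacency_matrix G D) $ x $ y
    = group_algebra_mult G (basic_sum D) (basic_sum C) $ (y \<otimes> inv x)"
  unfolding group_algebra_mult_nth matrix_matrix_mult_def vec_lambda_beta
  by (rule sum.reindex_bij_witness[of _ "\<lambda>w. w \<otimes> x" "\<lambda>z. z \<otimes> inv x"])
    (auto simp: adjacency_matrix_def basic_sum_nth mult_translate inv_mult_group m_assoc)

lemma adjacency_commute:
  assumes "C \<in> Q" "D \<in> Q"
  shows "adjacency_matrix G C *v (adjacency_matrix G D *v v)
    = adjacency_matrix G D *v (adjacency_matrix G C *v v)"
proof -
  have "adjacency_matrix G C ** adjacency_matrix G D = adjacency_matrix G D ** adjacency_matrix G C"
    using basic_sum_commute[OF assms] by (simp add: vec_eq_iff adjacency_product_nth)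
  then show ?thesis
    by (simp add: matrix_vector_mul_assoc)
qed

abbreviation gens :: "(complex ^ 'g ^ 'g) set"
  where "gens \<equiv> adjacency_matrix G ` Q \<union> dual_idempotent ` Q"

lemma adjoint_adjacency: "adjoint_matrix (adjacency_matrix G C) = adjacency_matrix G (set_inv C)"
  by (simp add: adjoint_matrix_def adjacency_matrix_def vec_eq_iff in_set_inv_iff inv_mult_group)

lemma adjoint_dual: "adjoint_matrix (dual_idempotent C) = dual_idempotent C"
  by (auto simp: adjoint_matrix_def dual_idempotent_def vec_eq_iff)

lemma adjoint_gens: "M \<in> gens \<Longrightarrow> adjoint_matrix M \<in> gens"
  by (auto simp: adjoint_adjacency adjoint_dual set_inv_class)

section \<open>The primary module and its complement\<close>

lemma adjacency_axis_nth:
  "(adjacency_matrix G C *v axis a 1) $ x = of_bool (a \<otimes> inv x \<in> C)"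
  by (simp add: adjacency_mult_nth axis_def if_distrib cong: if_cong)

lemma primary_module_combinations:
  "primary_module G Q = {(\<Sum>C\<in>Q. c C *s (adjacency_matrix G C *v axis \<one> 1)) | c. True}"
proof -
  have "(\<Sum>C\<in>Q. matrix_scale (c C) (adjacency_matrix G C)) *v axis \<one> 1
    = (\<Sum>C\<in>Q. c C *s (adjacency_matrix G C *v axis \<one> 1))" for c
    by (simp add: vec_eq_iff matrix_vector_mult_def sum_component matrix_scale_def axis_def
        if_distrib cong: if_cong)
  then show ?thesis
    unfolding primary_module_def adjacency_span_def setcompr_eq_image image_image by simp
qed

text \<open>\<open>A_C\<close> maps the basis vector at the identity to the indicator of the inverse class \<open>C\<^sup>*\<close>, so the
  primary module is spanned by the indicators of the classes.\<close>

lemma primary_module_iff: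
  "v \<in> primary_module G Q \<longleftrightarrow> (\<forall>C\<in>Q. \<forall>x\<in>C. \<forall>y\<in>C. v $ x = v $ y)"
proof -
  have nth: "(\<Sum>C\<in>Q. c C *s (adjacency_matrix G C *v axis \<one> 1)) $ x = c (set_inv D)"
    if "D \<in> Q" "x \<in> D" for c x D
  proof -
    have "inv x \<in> set_inv D"
      using that by (simp add: in_set_inv_iff)
    then have "inv x \<in> C \<longleftrightarrow> C = set_inv D" if "C \<in> Q" for C
      using class_unique[OF that set_inv_class[OF \<open>D \<in> Q\<close>]] by blast
    then have "(\<Sum>C\<in>Q. c C *s (adjacency_matrix G C *v axis \<one> 1)) $ x
      = (\<Sum>C\<in>Q. if C = set_inv D then c C else 0)"
      unfolding sum_component by (intro sum.cong) (simp_all add: adjacency_axis_nth)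
    then show ?thesis
      using that set_inv_class by simp
  qed
  show ?thesis
  proof
    assume "v \<in> primary_module G Q"
    then show "\<forall>C\<in>Q. \<forall>x\<in>C. \<forall>y\<in>C. v $ x = v $ y"
      using nth by (auto simp: primary_module_combinations)
  next
    assume const: "\<forall>C\<in>Q. \<forall>x\<in>C. \<forall>y\<in>C. v $ x = v $ y"
    define c where "c C = v $ (SOME x. x \<in> set_inv C)" for C
    have "v $ x = c (set_inv D)" if "D \<in> Q" "x \<in> D" for x D
    proof -
      have "set_inv (set_inv D) = D"
        by (auto simp: in_set_inv_iff)
      then have "c (set_inv D) = v $ (SOME x. x \<in> D)"
        by (simp add: c_def)
      moreover have "(SOME x. x \<in> D) \<in> D"
        using that by (metis someI)
      ultimately show ?thesis
        using const that by metis
    qed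
    then have "v $ x = (\<Sum>C\<in>Q. c C *s (adjacency_matrix G C *v axis \<one> 1)) $ x" for x
      using nth[of _ x c] class_exists[of x] by metis
    then have "v = (\<Sum>C\<in>Q. c C *s (adjacency_matrix G C *v axis \<one> 1))"
      by (simp only: vec_eq_iff) blast
    then show "v \<in> primary_module G Q"
      by (auto simp: primary_module_combinations)
  qed
qed

lemma subspace_primary_module: "vec.subspace (primary_module G Q)"
proof (rule vec.subspaceI)
  fix v w :: "complex ^ 'g"
  assume "v \<in> primary_module G Q" "w \<in> primary_module G Q"
  then show "v + w \<in> primary_module G Q"
    unfolding primary_module_iff vector_add_component by metis
next
  fix c and v :: "complex ^ 'g"
  assume "v \<in> primary_module G Q"
  then show "c *s v \<in> primary_module G Q"
    unfolding primary_module_iff vector_smult_component by metis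
qed (simp add: primary_module_iff)

text \<open>At \<open>z\<close>, the image of the basis vector at the identity under a product of two adjacency matrices is a
  structure constant of the class of \<open>z\<^sup>-\<^sup>1\<close>.\<close>

lemma submodule_primary_module: "submodule (matrix_subalgebra hull gens) (primary_module G Q)"
  unfolding submodule_hull_iff
proof (intro conjI ballI)
  show "vec.subspace (primary_module G Q)"
    by (rule subspace_primary_module)
  fix M v
  assume M: "M \<in> gens" and v: "v \<in> primary_module G Q"
  from M consider C where "C \<in> Q" "M = adjacency_matrix G C"
    | C where "C \<in> Q" "M = dual_idempotent C"
    by auto
  then show "M *v v \<in> primary_module G Q"
  proof cases
    case (1 C)
    have "adjacency_matrix G C *v (adjacency_matrix G D *v axis \<one> 1) \<in> primary_module G Q"
      if D: "D \<in> Q" for D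
      unfolding primary_module_iff
    proof (intro ballI)
      fix E x y
      assume E: "E \<in> Q" "x \<in> E" "y \<in> E"
      have nth: "(adjacency_matrix G C *v (adjacency_matrix G D *v axis \<one> 1)) $ z
        = group_algebra_mult G (basic_sum D) (basic_sum C) $ (inv z)" for z
        by (simp add: matrix_vector_mul_assoc)
          (simp add: matrix_vector_mult_def axis_def adjacency_product_nth if_distrib cong: if_cong)
      obtain l where "\<And>F z. F \<in> Q \<Longrightarrow> z \<in> F \<Longrightarrow>
        group_algebra_mult G (basic_sum D) (basic_sum C) $ z = l F"
        using structure_constants[OF D \<open>C \<in> Q\<close>] by blast
      then show "(adjacency_matrix G C *v (adjacency_matrix G D *v axis \<one> 1)) $ x
        = (adjacency_matrix G C *v (adjacency_matrix G D *v axis \<one> 1)) $ y"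
        using set_inv_class[OF E(1)] E(2,3) by (simp add: nth in_set_inv_iff)
    qed
    moreover obtain c where "v = (\<Sum>D\<in>Q. c D *s (adjacency_matrix G D *v axis \<one> 1))"
      using v unfolding primary_module_combinations by blast
    then have "M *v v
      = (\<Sum>D\<in>Q. c D *s (adjacency_matrix G C *v (adjacency_matrix G D *v axis \<one> 1)))"
      by (simp add: 1 matrix_vector_mult_sum vector_scalar_commute)
    ultimately show ?thesis
      using subspace_primary_module by (simp add: vec.subspace_sum vec.subspace_scale)
  next
    case (2 C)
    show ?thesis
      unfolding primary_module_iff
    proof (intro ballI)
      fix D x y
      assume D: "D \<in> Q" and xy: "x \<in> D" "y \<in> D"
      have "z \<in> C \<longleftrightarrow> C = D" if "z \<in> D" for z
        using class_unique[OF 2(1) D _ that] that by blast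
      moreover have "v $ x = v $ y"
        using v D xy unfolding primary_module_iff by blast
      ultimately show "(M *v v) $ x = (M *v v) $ y"
        using xy by (simp add: 2(2) dual_idempotent_mult_nth)
    qed
  qed
qed

text \<open>The orthogonal complement of the primary module.\<close>

definition zero_sum :: "(complex ^ 'g) set"
  where "zero_sum = {v. \<forall>C\<in>Q. (\<Sum>x\<in>C. v $ x) = 0}"

lemma sum_over_classes: "(\<Sum>x\<in>UNIV. f x) = (\<Sum>C\<in>Q. \<Sum>x\<in>C. f x)"
proof -
  have "\<Union>Q = UNIV"
    using class_exists by blast
  then show ?thesis
    using sum.Union_disjoint[of Q f] class_unique by auto
qed

lemma subspace_zero_sum: "vec.subspace zero_sum"
  by (auto simp: vec.subspace_def zero_sum_def sum.distrib simp flip: sum_distrib_left)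

text \<open>The sum of \<open>A_C v\<close> over \<open>D\<close> pairs \<open>v\<close> with the product of the class sums of \<open>C\<close> and \<open>D\<close>.  This product
  is constant on classes, so only the class sums of \<open>v\<close> enter.\<close>

lemma submodule_zero_sum: "submodule (matrix_subalgebra hull gens) zero_sum"
  unfolding submodule_hull_iff
proof (intro conjI ballI)
  show "vec.subspace zero_sum"
    by (rule subspace_zero_sum)
  fix M v
  assume M: "M \<in> gens" and v: "v \<in> zero_sum"
  from M consider C where "C \<in> Q" "M = adjacency_matrix G C"
    | C where "C \<in> Q" "M = dual_idempotent C"
    by auto
  then show "M *v v \<in> zero_sum"
  proof cases
    case (1 C)
    have "(\<Sum>x\<in>D. (adjacency_matrix G C *v v) $ x) = 0" if D: "D \<in> Q" for D
    proof -
      obtain l where l: "\<And>F z. F \<in> Q \<Longrightarrow> z \<in> F \<Longrightarrow>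
        group_algebra_mult G (basic_sum C) (basic_sum D) $ z = l F"
        using structure_constants[OF \<open>C \<in> Q\<close> D] by blast
      have "(\<Sum>x\<in>D. (adjacency_matrix G C *v v) $ x)
        = (\<Sum>z\<in>UNIV. \<Sum>x\<in>D. of_bool (z \<otimes> inv x \<in> C) * v $ z)"
        unfolding adjacency_mult_nth by (rule sum.swap)
      also have "\<dots> = (\<Sum>z\<in>UNIV. group_algebra_mult G (basic_sum C) (basic_sum D) $ z * v $ z)"
        unfolding group_algebra_mult_nth basic_sum_nth sum_distrib_right
        by (intro sum.cong refl sum.mono_neutral_cong_left) auto
      also have "\<dots> = (\<Sum>E\<in>Q. \<Sum>z\<in>E. l E * v $ z)"
        unfolding sum_over_classes by (intro sum.cong) (auto simp: l)
      also have "\<dots> = 0"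
        using v by (simp add: zero_sum_def flip: sum_distrib_left)
      finally show ?thesis .
    qed
    then show ?thesis
      by (simp add: zero_sum_def 1)
  next
    case (2 C)
    have "(\<Sum>x\<in>D. (dual_idempotent C *v v) $ x) = 0" if "D \<in> Q" for D
    proof (cases "D = C")
      case True
      then show ?thesis
        using v that by (simp add: dual_idempotent_mult_nth zero_sum_def)
    next
      case False
      then have "\<And>x. x \<in> D \<Longrightarrow> x \<notin> C"
        using that 2(1) class_unique by blast
      then show ?thesis
        by (simp add: dual_idempotent_mult_nth)
    qed
    then show ?thesis
      by (simp add: zero_sum_def 2)
  qed
qed

lemma axis_one_in_primary_module: "axis \<one> 1 \<in> primary_module G Q"
  using class_unique[OF _ one_class] by (auto simp: primary_module_iff axis_def)

text \<open>An isomorphism commutes with the idempotent of \<open>{e}\<close>.  This idempotent fixes the basis vector at the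
  identity, which lies in the primary module, but it kills every vector whose sum over \<open>{e}\<close> is \<open>0\<close>.\<close>

lemma zero_sum_not_isomorphic_primary:
  assumes U: "submodule (matrix_subalgebra hull gens) U" "U \<subseteq> zero_sum"
  shows "\<not> isomorphic_submodules (matrix_subalgebra hull gens) U (primary_module G Q)"
proof
  assume "isomorphic_submodules (matrix_subalgebra hull gens) U (primary_module G Q)"
  then obtain f where bij: "bij_betw f U (primary_module G Q)"
    and scale: "\<And>c u. u \<in> U \<Longrightarrow> f (c *s u) = c *s f u"
    and act: "\<And>M u. M \<in> matrix_subalgebra hull gens \<Longrightarrow> u \<in> U \<Longrightarrow> f (M *v u) = M *v f u"
    unfolding isomorphic_submodules_def by blast
  let ?E = "dual_idempotent {\<one>} :: complex ^ 'g ^ 'g"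
  obtain u where u: "u \<in> U" "f u = axis \<one> 1"
    using bij axis_one_in_primary_module by (metis bij_betw_def imageE)
  have "?E \<in> matrix_subalgebra hull gens"
    using one_class by (intro hull_inc) auto
  then have "f (?E *v u) = ?E *v axis \<one> 1"
    using act u by simp
  moreover have "u $ \<one> = 0"
    using u(1) U(2) one_class by (auto simp: zero_sum_def dest!: bspec)
  then have "?E *v u = 0 *s u"
    by (auto simp: vec_eq_iff dual_idempotent_mult_nth)
  moreover have "?E *v axis \<one> 1 = (axis \<one> 1 :: complex ^ 'g)"
    by (auto simp: vec_eq_iff dual_idempotent_mult_nth axis_def)
  ultimately show False
    using scale[OF u(1), of 0] by (simp add: axis_eq_0_iff)
qed

text \<open>The entry of \<open>A_D w\<close> at the identity is the sum of \<open>w\<close> over \<open>D\<close>.  If it is nonzero, then cutting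
  down to this entry gives the basis vector at the identity, so the module contains the whole primary
  module and equals it by irreducibility.\<close>

lemma irreducible_not_primary_zero_sum:
  assumes irr: "irreducible_submodule (matrix_subalgebra hull gens) W"
    and niso: "\<not> isomorphic_submodules (matrix_subalgebra hull gens) W (primary_module G Q)"
  shows "W \<subseteq> zero_sum"
proof (rule ccontr)
  assume "\<not> W \<subseteq> zero_sum"
  then obtain w D where w: "w \<in> W" and D: "D \<in> Q" "(\<Sum>x\<in>D. w $ x) \<noteq> 0"
    by (auto simp: zero_sum_def)
  have W: "vec.subspace W" and inv: "\<And>M w. M \<in> gens \<Longrightarrow> w \<in> W \<Longrightarrow> M *v w \<in> W"
    using irr by (auto simp: irreducible_submodule_def submodule_hull_iff)
  let ?s = "\<Sum>x\<in>D. w $ x"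
  have "(adjacency_matrix G D *v w) $ \<one> = ?s"
    by (auto simp: adjacency_mult_nth intro!: sum.mono_neutral_cong_right)
  then have "dual_idempotent {\<one>} *v (adjacency_matrix G D *v w) = ?s *s axis \<one> 1"
    by (auto simp: vec_eq_iff dual_idempotent_mult_nth axis_def)
  then have "?s *s axis \<one> 1 \<in> W"
    using inv[of "dual_idempotent {\<one>}", OF _ inv[of "adjacency_matrix G D", OF _ w]] D(1) one_class
    by auto
  then have "inverse ?s *s (?s *s axis \<one> 1) \<in> W"
    by (rule vec.subspace_scale[OF W])
  then have "axis \<one> 1 \<in> W"
    using D(2) by (simp add: vector_smult_assoc)
  then have "primary_module G Q \<subseteq> W"
    unfolding primary_module_combinations
    by (auto intro!: vec.subspace_sum[OF W] vec.subspace_scale[OF W] inv)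
  moreover have "primary_module G Q \<noteq> {0}"
    using axis_one_in_primary_module by (metis axis_eq_0_iff singletonD zero_neq_one)
  ultimately have "W = primary_module G Q"
    using irr submodule_primary_module by (auto simp: irreducible_submodule_def)
  then have "isomorphic_submodules (matrix_subalgebra hull gens) W (primary_module G Q)"
    unfolding isomorphic_submodules_def by (intro exI[of _ id]) auto
  then show False
    using niso by simp
qed

section \<open>Commuting generators and products of principal sets\<close>

lemma almost_commutative_iff_commuting:
  "terwilliger_almost_commutative G Q \<longleftrightarrow>
    (\<forall>M\<in>gens. \<forall>N\<in>gens. \<forall>v\<in>zero_sum. M *v (N *v v) = N *v (M *v v))"
  (is "?A \<longleftrightarrow> ?B")
proof
  assume ?A
  then have "vec.dim U = 1"
    if "irreducible_submodule (matrix_subalgebra hull gens) U" "U \<subseteq> zero_sum" for U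
  proof -
    have "submodule (matrix_subalgebra hull gens) U"
      using that(1) unfolding irreducible_submodule_def by blast
    then have "\<not> isomorphic_submodules (matrix_subalgebra hull gens) U (primary_module G Q)"
      using zero_sum_not_isomorphic_primary that(2) by blast
    then show ?thesis
      using \<open>?A\<close> that(1)
      unfolding terwilliger_almost_commutative_def terwilliger_algebra_def by blast
  qed
  then show ?B
    using irreducibles_dim_1_imp_commuting[OF adjoint_gens submodule_zero_sum] by blast
next
  assume comm: ?B
  show ?A
    unfolding terwilliger_almost_commutative_def terwilliger_algebra_def
  proof (intro allI impI, elim conjE)
    fix W
    assume irr: "irreducible_submodule (matrix_subalgebra hull gens) W"
      and "\<not> isomorphic_submodules (matrix_subalgebra hull gens) W (primary_module G Q)"
    then have "W \<subseteq> zero_sum"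
      by (rule irreducible_not_primary_zero_sum)
    then show "vec.dim W = 1"
      using comm by (intro irreducible_commuting_dim_1[OF irr]) blast
  qed
qed

text \<open>In the blocks of the adjacency matrices between two different classes, every row is constant; \<open>D\<close> is
  the class of the columns and \<open>x\<close> the row.\<close>

definition constant_off_diagonal :: bool
  where "constant_off_diagonal \<longleftrightarrow>
    (\<forall>C\<in>Q. \<forall>D\<in>Q. \<forall>x. \<forall>y\<in>D. \<forall>z\<in>D. x \<notin> D \<and> y \<otimes> inv x \<in> C \<longrightarrow> z \<otimes> inv x \<in> C)"

lemma constant_off_diagonalD:
  assumes "constant_off_diagonal" "C \<in> Q" "D \<in> Q" "y \<in> D" "z \<in> D" "x \<notin> D" "y \<otimes> inv x \<in> C"
  shows "z \<otimes> inv x \<in> C"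
  by (rule assms(1)[unfolded constant_off_diagonal_def, rule_format,
        OF assms(2-5) conjI[OF assms(6,7)]])

text \<open>A row of a block is constant if and only if it is orthogonal to all vectors of sum 0.  Differences
  of two basis vectors in one class test this for the first direction.  In the second direction, the
  vanishing of the off-diagonal blocks on vectors of sum 0 means that \<open>A_C\<close> preserves the
  decomposition along classes, which is what commuting with the \<open>E_D\<^sup>*\<close> says.\<close>

lemma commuting_iff_constant_off_diagonal:
  "(\<forall>M\<in>gens. \<forall>N\<in>gens. \<forall>v\<in>zero_sum. M *v (N *v v) = N *v (M *v v)) \<longleftrightarrow> constant_off_diagonal"
  (is "?A \<longleftrightarrow> ?B")
proof
  assume comm: ?A
  show ?B
    unfolding constant_off_diagonal_def
  proof (intro ballI allI impI)
    fix C D x y z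
    assume CD: "C \<in> Q" "D \<in> Q" and yz: "y \<in> D" "z \<in> D" and x: "x \<notin> D \<and> y \<otimes> inv x \<in> C"
    obtain E where E: "E \<in> Q" "x \<in> E"
      using class_exists by blast
    then have "E \<noteq> D"
      using x by auto
    then have "y \<notin> E" "z \<notin> E"
      using E(1) CD(2) yz class_unique by blast+
    define v :: "complex ^ 'g" where "v = axis y 1 - axis z 1"
    have "y \<in> F \<longleftrightarrow> z \<in> F" if "F \<in> Q" for F
      using that CD(2) yz class_unique by blast
    then have "v \<in> zero_sum"
      by (simp add: zero_sum_def v_def axis_def sum_subtractf)
    then have "dual_idempotent E *v (adjacency_matrix G C *v v)
      = adjacency_matrix G C *v (dual_idempotent E *v v)"
      using comm CD E by blast
    also have "dual_idempotent E *v v = 0"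
      using \<open>y \<notin> E\<close> \<open>z \<notin> E\<close> by (auto simp: vec_eq_iff dual_idempotent_mult_nth v_def axis_def)
    finally have "(dual_idempotent E *v (adjacency_matrix G C *v v)) $ x = 0"
      by simp
    then have "(adjacency_matrix G C *v v) $ x = 0"
      using E by (simp add: dual_idempotent_mult_nth)
    then show "z \<otimes> inv x \<in> C"
      using x by (simp add: v_def matrix_vector_mult_diff_distrib adjacency_axis_nth)
  qed
next
  assume const: ?B
  have vanish: "(\<Sum>z\<in>D. of_bool (z \<otimes> inv x \<in> C) * v $ z) = 0"
    if "C \<in> Q" "D \<in> Q" "x \<notin> D" "v \<in> zero_sum" for C D x v
  proof (cases "\<exists>y\<in>D. y \<otimes> inv x \<in> C")
    case True
    then have "\<forall>z\<in>D. z \<otimes> inv x \<in> C"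
      using constant_off_diagonalD[OF const] that by blast
    then show ?thesis
      using that by (simp add: zero_sum_def)
  qed simp
  have ad: "dual_idempotent D *v (adjacency_matrix G C *v v)
    = adjacency_matrix G C *v (dual_idempotent D *v v)"
    if "C \<in> Q" "D \<in> Q" "v \<in> zero_sum" for C D v
    unfolding vec_eq_iff
  proof
    fix x
    have r: "(adjacency_matrix G C *v (dual_idempotent D *v v)) $ x
      = (\<Sum>z\<in>D. of_bool (z \<otimes> inv x \<in> C) * v $ z)"
      unfolding adjacency_mult_nth dual_idempotent_mult_nth
      by (auto intro!: sum.mono_neutral_cong_right)
    show "(dual_idempotent D *v (adjacency_matrix G C *v v)) $ x
      = (adjacency_matrix G C *v (dual_idempotent D *v v)) $ x"
    proof (cases "x \<in> D")
      case False
      then show ?thesis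
        unfolding r using that vanish by (simp add: dual_idempotent_mult_nth)
    next
      case True
      have "(adjacency_matrix G C *v v) $ x
        = (\<Sum>E\<in>Q. \<Sum>z\<in>E. of_bool (z \<otimes> inv x \<in> C) * v $ z)"
        by (simp only: adjacency_mult_nth sum_over_classes)
      also have "\<dots> = (\<Sum>E\<in>{D}. \<Sum>z\<in>E. of_bool (z \<otimes> inv x \<in> C) * v $ z)"
      proof (intro sum.mono_neutral_right ballI)
        fix E
        assume E: "E \<in> Q - {D}"
        then have "x \<notin> E"
          using True that class_unique by blast
        then show "(\<Sum>z\<in>E. of_bool (z \<otimes> inv x \<in> C) * v $ z) = 0"
          using vanish E that by blast
      qed (use that in auto)
      finally show ?thesis
        unfolding r using True by (simp add: dual_idempotent_mult_nth)
    qed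
  qed
  have dd: "dual_idempotent C *v (dual_idempotent D *v v)
    = dual_idempotent D *v (dual_idempotent C *v v)" for C D and v :: "complex ^ 'g"
    by (simp add: vec_eq_iff dual_idempotent_mult_nth mult.left_commute)
  show ?A
    using ad dd adjacency_commute by auto
qed

definition single_class_products :: bool
  where "single_class_products \<longleftrightarrow>
    (\<forall>C\<in>Q. \<forall>D\<in>Q. \<forall>E\<in>Q. \<forall>x\<in>C. \<forall>y\<in>D. x \<otimes> y \<in> E \<and> C \<noteq> set_inv D \<longrightarrow> C <#> D = E)"

text \<open>The coefficient at \<open>z\<close> of the product of the class sums of \<open>C\<close> and \<open>D\<close> counts the ways to write
  \<open>z\<close> as a product.  It is constant on classes, so \<open>C D\<close> is a union of classes.\<close>

lemma class_subset_set_mult: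
  assumes "C \<in> Q" "D \<in> Q" "E \<in> Q" "x \<in> C" "y \<in> D" "x \<otimes> y \<in> E"
  shows "E \<subseteq> C <#> D"
proof
  fix z
  assume "z \<in> E"
  let ?N = "\<lambda>z. {w. z \<otimes> inv w \<in> C \<and> w \<in> D}"
  have count: "group_algebra_mult G (basic_sum C) (basic_sum D) $ z = of_nat (card (?N z))" for z
  proof -
    have "group_algebra_mult G (basic_sum C) (basic_sum D) $ z = (\<Sum>w\<in>UNIV. of_bool (w \<in> ?N z))"
      unfolding group_algebra_mult_nth basic_sum_nth by (intro sum.cong) auto
    also have "\<dots> = of_nat (card (?N z))"
      by (simp add: sum.If_cases of_bool_def)
    finally show ?thesis .
  qed
  obtain l where "\<And>F z. F \<in> Q \<Longrightarrow> z \<in> F \<Longrightarrow>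
    group_algebra_mult G (basic_sum C) (basic_sum D) $ z = l F"
    using structure_constants[OF assms(1,2)] by blast
  then have "of_nat (card (?N z)) = (of_nat (card (?N (x \<otimes> y))) :: complex)"
    using count \<open>z \<in> E\<close> assms by metis
  then have "card (?N z) = card (?N (x \<otimes> y))"
    by simp
  moreover have "y \<in> ?N (x \<otimes> y)"
    using assms by (simp add: mult_translate)
  ultimately have "card (?N z) \<noteq> 0"
    by (metis card_0_eq empty_iff finite)
  then obtain w where "z \<otimes> inv w \<in> C" "w \<in> D"
    by (metis (mono_tags, lifting) card.empty ex_in_conv mem_Collect_eq)
  moreover have "z = (z \<otimes> inv w) \<otimes> w"
    by (simp add: mult_translate)
  ultimately show "z \<in> C <#> D"
    unfolding set_mult_def by blast
qed

text \<open>If \<open>x y \<in> E\<close>, the constant row at \<open>y\<^sup>-\<^sup>1\<close> of the block with column class \<open>C\<close> replaces \<open>x\<close> by any \<open>a \<in> C\<close>.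
  For \<open>y\<close>, the same is applied to \<open>(a y)\<^sup>-\<^sup>1 = y\<^sup>-\<^sup>1 a\<^sup>-\<^sup>1 \<in> E\<^sup>*\<close>, a row at \<open>a\<close> with column class \<open>D\<^sup>*\<close>.
  Both blocks are off the diagonal because \<open>C \<noteq> D\<^sup>*\<close>.\<close>

lemma constant_off_diagonal_iff_single_class_products:
  "constant_off_diagonal \<longleftrightarrow> single_class_products"
proof
  assume constant_off_diagonal
  note const = constant_off_diagonalD[OF this]
  show single_class_products
    unfolding single_class_products_def
  proof (intro ballI impI)
    fix C D E x y
    assume CDE: "C \<in> Q" "D \<in> Q" "E \<in> Q" and xy: "x \<in> C" "y \<in> D"
      and h: "x \<otimes> y \<in> E \<and> C \<noteq> set_inv D"
    have disj: "a \<notin> set_inv D" if "a \<in> C" for a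
      using that h class_unique[OF CDE(1) set_inv_class[OF CDE(2)]] by blast
    have "a \<otimes> b \<in> E" if ab: "a \<in> C" "b \<in> D" for a b
    proof -
      have "inv y \<notin> C"
        using disj[of "inv y"] xy(2) by (auto simp: in_set_inv_iff)
      then have "a \<otimes> inv (inv y) \<in> E"
        using const[OF CDE(3,1) xy(1) ab(1), of "inv y"] h by simp
      then have "inv y \<otimes> inv a \<in> set_inv E"
        by (simp add: in_set_inv_iff inv_mult_group)
      moreover have "inv y \<in> set_inv D" "inv b \<in> set_inv D"
        using xy(2) ab(2) by (simp_all add: in_set_inv_iff)
      ultimately have "inv b \<otimes> inv a \<in> set_inv E"
        using const[OF set_inv_class[OF CDE(3)] set_inv_class[OF CDE(2)]] disj[OF ab(1)] by blast
      then show ?thesis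
        by (simp add: in_set_inv_iff inv_mult_group)
    qed
    then have "C <#> D \<subseteq> E"
      by (auto simp: set_mult_def)
    then show "C <#> D = E"
      using class_subset_set_mult[OF CDE xy] h by blast
  qed
next
  assume single: single_class_products
  show constant_off_diagonal
    unfolding constant_off_diagonal_def
  proof (intro ballI allI impI)
    fix C D x y z
    assume CD: "C \<in> Q" "D \<in> Q" and yz: "y \<in> D" "z \<in> D" and x: "x \<notin> D \<and> y \<otimes> inv x \<in> C"
    obtain E where E: "E \<in> Q" "inv x \<in> E"
      using class_exists by blast
    then have "D \<noteq> set_inv E"
      using x by (auto simp: in_set_inv_iff)
    then have "D <#> E = C"
      using single CD yz(1) E x unfolding single_class_products_def by blast
    then show "z \<otimes> inv x \<in> C"
      using yz(2) E(2) by (auto simp: set_mult_def)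
  qed
qed

end

theorem theorem2p2:
  fixes G :: "('g::finite, 'b) monoid_scheme" (structure)
    and S :: "(complex ^ 'g) set"
    and P :: "nat \<Rightarrow> 'g set"
    and d :: nat
  assumes "group G" and "carrier G = UNIV"
    and "commutative_schur_ring G (P ` {0..d}) S"
    and "inj_on P {0..d}" and "P 0 = {\<one>}"
  shows "terwilliger_almost_commutative G (P ` {0..d}) \<longleftrightarrow>
    (\<forall>x\<in>carrier G. \<forall>y\<in>carrier G. \<forall>i\<in>{0..d}. \<forall>j\<in>{0..d}. \<forall>h\<in>{0..d}.
       x \<in> P i \<and> y \<in> P j \<and> x \<otimes> y \<in> P h \<and> P i \<noteq> set_inv (P j) \<longrightarrow>
       P i <#> P j = P h)"
proof -
  interpret commutative_schur_partition G "P ` {0..d}" S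
    using assms by (simp add: commutative_schur_partition_def commutative_schur_partition_axioms_def)
  have "terwilliger_almost_commutative G (P ` {0..d}) \<longleftrightarrow> single_class_products"
    using almost_commutative_iff_commuting commuting_iff_constant_off_diagonal
      constant_off_diagonal_iff_single_class_products by blast
  also have "\<dots> \<longleftrightarrow> (\<forall>x\<in>carrier G. \<forall>y\<in>carrier G. \<forall>i\<in>{0..d}. \<forall>j\<in>{0..d}. \<forall>h\<in>{0..d}.
       x \<in> P i \<and> y \<in> P j \<and> x \<otimes> y \<in> P h \<and> P i \<noteq> set_inv (P j) \<longrightarrow>
       P i <#> P j = P h)"
    unfolding single_class_products_def by (simp add: carrier_UNIV) blast
  finally show ?thesis .
qed

end
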